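(* Let $G_5(s)=1+2^s+3^s+4^s+5^s$ for $s\in\mathbb{C}$, and let $R_5:=\overline{\{\operatorname{Re} s: s\in\mathbb{C},\ G_5(s)=0\}}$. Then $[-0.55,1]\subset R_5$.
   Context: The overline denotes closure in $\mathbb{R}$; $m^s=e^{s\log m}$ with $\log m$ the real logarithm. *)

theory Defs
  imports "HOL-Analysis.Analysis"
begin

definition G5 :: "complex \<Rightarrow> complex" where
  "G5 s = 1 + 2 powr s + 3 powr s + 4 powr s + 5 powr s"

(* The complex powr uses the principal branch of the logarithm, which is the
   real logarithm on positive integers. *)
lemma of_nat_powr_eq_exp_real_ln:
  assumes "m > 0"
  shows "(of_nat m :: complex) powr s = exp (s * of_real (ln (real m)))"
  using assms Ln_of_real[of "real m"] by (simp add: powr_def)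

definition R5 :: "real set" where
  "R5 = closure {Re s | s. G5 s = 0}"

end

theory Submission
  imports Defs "HOL-Complex_Analysis.Complex_Analysis"
begin

text \<open>
  Since \<open>ln 2\<close>, \<open>ln 3\<close>, \<open>ln 5\<close> are linearly independent over the integers, Kronecker's theorem
  makes the vertical translates of \<open>G5\<close> approach every function
  \<open>1 + 2^s x + 3^s y + 4^s x^2 + 5^s v\<close> with unimodular \<open>x\<close>, \<open>y\<close>, \<open>v\<close>. By Hurwitz's theorem a real
  zero \<open>\<sigma>\<close> of such a function is a limit of real parts of zeros of \<open>G5\<close>. To find such a zero
  take \<open>x = y = cis \<theta>\<close>: a suitable \<open>v\<close> exists once \<open>1 + 2^\<sigma> x + 3^\<sigma> x + 4^\<sigma> x^2\<close> has modulus
  \<open>5^\<sigma>\<close>. This modulus is at least \<open>5^\<sigma>\<close> at \<open>\<theta> = 0\<close> and at most \<open>5^\<sigma>\<close> at \<open>\<theta> = \<pi>\<close>. The lower end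
  \<open>-0.55\<close> enters only through \<open>1 \<le> 2^\<sigma> + 5^\<sigma>\<close>.
\<close>

section \<open>Logarithms of primes and simultaneous approximation\<close>

text \<open>Unique factorization: exponentiating the relation gives two equal products of prime
  powers, and comparing the multiplicity of \<open>q\<close> on both sides forces
  \<open>c q = 0\<close>.\<close>

lemma ln_primes_independent:
  fixes c :: "nat \<Rightarrow> int"
  assumes P: "finite P" "\<And>p. p \<in> P \<Longrightarrow> prime p"
    and eq: "(\<Sum>p\<in>P. of_int (c p) * ln (real p)) = 0" and "q \<in> P"
  shows "c q = 0"
proof -
  have pos: "real p > 0" if "p \<in> P" for p
    using P(2)[OF that] prime_gt_0_nat by auto
  have ln_prod': "ln (real (\<Prod>p\<in>P. p ^ f p)) = (\<Sum>p\<in>P. real (f p) * ln (real p))"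
    for f :: "nat \<Rightarrow> nat"
    using pos P(1) by (simp add: ln_prod ln_realpow)
  \<comment> \<open>As \<open>nat\<close> truncates negative integers to 0, this splits
    \<open>c p\<close> into positive and negative parts; each part then serves as natural exponents
    on one side.\<close>
  have "real (nat (c p)) = real (nat (- c p)) + of_int (c p)" for p
    by linarith
  then have "ln (real (\<Prod>p\<in>P. p ^ nat (c p))) = ln (real (\<Prod>p\<in>P. p ^ nat (- c p)))"
    unfolding ln_prod' using eq by (simp add: distrib_right sum.distrib)
  moreover have "real (\<Prod>p\<in>P. p ^ f p) > 0" for f :: "nat \<Rightarrow> nat"
    using pos by (auto intro!: prod_pos)
  ultimately have "real (\<Prod>p\<in>P. p ^ nat (c p)) = real (\<Prod>p\<in>P. p ^ nat (- c p))"
    by (simp only: ln_inj_iff)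
  then have "(\<Prod>p\<in>P. p ^ nat (c p)) = (\<Prod>p\<in>P. p ^ nat (- c p))"
    by (simp only: of_nat_eq_iff)
  then have "multiplicity q (\<Prod>p\<in>P. p ^ nat (c p)) = multiplicity q (\<Prod>p\<in>P. p ^ nat (- c p))"
    by simp
  then have "nat (c q) = nat (- c q)"
    using P \<open>q \<in> P\<close> by (simp add: multiplicity_prod_prime_powers)
  then show ?thesis
    by linarith
qed

lemma dist_cis_le: "dist (cis a) (cis b) \<le> \<bar>a - b\<bar>"
proof -
  have "cis a - cis b = cis b * (cis (a - b) - 1)"
    by (simp add: right_diff_distrib cis_mult)
  then have "dist (cis a) (cis b) = 2 * \<bar>sin ((a - b) / 2)\<bar>"
    using dist_exp_i_1[of "a - b"] by (simp add: dist_norm norm_mult cis_conv_exp)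
  also have "\<dots> \<le> \<bar>a - b\<bar>"
    using abs_sin_x_le_abs_x[of "(a - b) / 2"] by simp
  finally show ?thesis .
qed

lemma prime_powers_dense_torus:
  fixes u :: "nat \<Rightarrow> complex"
  assumes P: "finite P" "\<And>p. p \<in> P \<Longrightarrow> prime p"
    and u: "\<And>p. p \<in> P \<Longrightarrow> norm (u p) = 1" and "\<epsilon> > 0"
  obtains t :: real where "\<And>p. p \<in> P \<Longrightarrow> dist (cis (t * ln (real p))) (u p) < \<epsilon>"
proof -
  interpret Z: module "\<lambda>r. (*) (real_of_int r)"
    by (simp add: module.intro distrib_left mult.commute)
  have inj: "inj_on (\<lambda>p. ln (real p)) P"
    using P(2) prime_gt_0_nat by (fastforce intro!: inj_onI)
  have indep: "Z.independent ((\<lambda>p. ln (real p)) ` P)"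
  proof -
    have "\<forall>x\<in>(\<lambda>p. ln (real p)) ` P. f x = 0"
      if "(\<Sum>x\<in>(\<lambda>p. ln (real p)) ` P. real_of_int (f x) * x) = 0" for f
      using ln_primes_independent[OF P, of "\<lambda>p. f (ln (real p))"] that inj
      by (auto simp: sum.reindex)
    then show ?thesis
      using P(1) by (auto simp: Z.dependent_finite)
  qed
  obtain e where e: "bij_betw e {..<card P} P"
    using ex_bij_betw_nat_finite[OF P(1)] by (auto simp: atLeast0LessThan)
  \<comment> \<open>Kronecker's theorem approximates modulo 1, so the targets are angles in full
    turns and the tolerance is divided by \<open>2 * pi\<close>. Rescaling \<open>t\<close> by
    \<open>2 * pi\<close> returns to radians, where the integers \<open>h i\<close> vanish under
    \<open>cis\<close>.\<close>
  define \<alpha> where "\<alpha> i = Arg (u (e i)) / (2 * pi)" for i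
  have im: "(\<lambda>i. ln (real (e i))) ` {..<card P} = (\<lambda>p. ln (real p)) ` P"
    using e by (metis bij_betw_def image_image)
  obtain t h where t: "\<And>i. i < card P \<Longrightarrow> \<bar>t * ln (real (e i)) - of_int (h i) - \<alpha> i\<bar> < \<epsilon> / (2 * pi)"
  proof (rule Kronecker_thm_1[where \<alpha> = \<alpha>])
    show "Z.independent ((\<lambda>i. ln (real (e i))) ` {..<card P})"
      unfolding im by (fact indep)
    show "inj_on (\<lambda>i. ln (real (e i))) {..<card P}"
      using comp_inj_on[of e "{..<card P}" "\<lambda>p. ln (real p)"] e inj
      by (auto simp: bij_betw_def comp_def)
    show "\<epsilon> / (2 * pi) > 0"
      using \<open>\<epsilon> > 0\<close> by simp
  qed blast
  have "dist (cis (2 * pi * t * ln (real p))) (u p) < \<epsilon>" if "p \<in> P" for p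
  proof -
    obtain i where i: "i < card P" "p = e i"
      using e \<open>p \<in> P\<close> unfolding bij_betw_def by (metis imageE lessThan_iff)
    have "2 * pi * t * ln (real p) - 2 * pi * of_int (h i) - 2 * pi * \<alpha> i
        = 2 * pi * (t * ln (real p) - of_int (h i) - \<alpha> i)"
      by (simp add: algebra_simps)
    then have "\<bar>2 * pi * t * ln (real p) - 2 * pi * of_int (h i) - 2 * pi * \<alpha> i\<bar> < \<epsilon>"
      using t[OF i(1)] i(2) by (simp add: abs_mult pos_less_divide_eq mult.commute)
    then have "dist (cis (2 * pi * t * ln (real p) - 2 * pi * of_int (h i))) (cis (2 * pi * \<alpha> i)) < \<epsilon>"
      by (rule le_less_trans[OF dist_cis_le])
    moreover have "cis (2 * pi * \<alpha> i) = u p"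
      using rcis_cmod_Arg[of "u p"] u[OF that] i(2) by (simp add: \<alpha>_def rcis_def)
    moreover have "cis (2 * pi * t * ln (real p) - 2 * pi * of_int (h i)) = cis (2 * pi * t * ln (real p))"
      by (simp flip: cis_divide)
    ultimately show ?thesis
      by simp
  qed
  then show thesis
    by (rule that)
qed

section \<open>Limits of vertical translates\<close>

text \<open>The unimodular \<open>x\<close>, \<open>y\<close>, \<open>v\<close> replace
  \<open>2^(it)\<close>, \<open>3^(it)\<close>, \<open>5^(it)\<close>; the factor of
  \<open>4^s\<close> must be the square of \<open>x\<close> because \<open>4 = 2^2\<close>.\<close>

definition twisted_G5 :: "complex \<Rightarrow> complex \<Rightarrow> complex \<Rightarrow> complex \<Rightarrow> complex" where
  "twisted_G5 x y v s = 1 + 2 powr s * x + 3 powr s * y + 4 powr s * x\<^sup>2 + 5 powr s * v"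

lemma G5_vertical_shift:
  "G5 (s + \<i> * of_real t) = twisted_G5 (cis (t * ln 2)) (cis (t * ln 3)) (cis (t * ln 5)) s"
proof -
  have shift: "of_nat m powr (s + \<i> * of_real t) = of_nat m powr s * cis (t * ln (real m))" if "m > 0" for m
    using that by (simp add: of_nat_powr_eq_exp_real_ln cis_conv_exp distrib_right exp_add mult.assoc)
  have "ln 4 = 2 * ln (2::real)"
    using ln_realpow[of 2 2] by simp
  then have "cis (t * ln 4) = (cis (t * ln 2))\<^sup>2"
    by (simp add: Complex.DeMoivre mult_ac)
  then show ?thesis
    using shift[of 2] shift[of 3] shift[of 4] shift[of 5] by (simp add: G5_def twisted_G5_def)
qed

lemma holomorphic_twisted_G5: "twisted_G5 x y v holomorphic_on S"
  unfolding twisted_G5_def by (intro holomorphic_intros) auto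

text \<open>As \<open>Re s\<close> tends to \<open>-\<infinity>\<close> only the term 1 survives; \<open>s = -3\<close> is already far enough.\<close>
lemma twisted_G5_minus_3:
  assumes "norm x = 1" "norm y = 1" "norm v = 1"
  shows "twisted_G5 x y v (-3) \<noteq> 0"
proof
  have m: "norm (of_nat m powr (-3 :: complex) * w) = 1 / real m ^ 3" if "m > 0" "norm w = 1" for m w
    using that by (simp add: norm_mult norm_powr_real_powr powr_minus norm_inverse norm_power divide_inverse)
  assume "twisted_G5 x y v (-3) = 0"
  then have "norm (1 :: complex) = norm (2 powr (-3) * x + 3 powr (-3) * y + 4 powr (-3) * x\<^sup>2 + 5 powr (-3) * v)"
    by (simp add: twisted_G5_def add.assoc add_eq_0_iff)
  also have "\<dots> \<le> norm (2 powr (-3) * x) + norm (3 powr (-3) * y) + norm (4 powr (-3) * x\<^sup>2) + norm (5 powr (-3) * v)"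
    by (intro order.trans[OF norm_triangle_ineq] add_mono order.refl)
  also have "\<dots> = 1 / 2 ^ 3 + 1 / 3 ^ 3 + 1 / 4 ^ 3 + 1 / 5 ^ 3"
    using m[of 2 x] m[of 3 y] m[of 4 "x\<^sup>2"] m[of 5 v] assms by (simp add: norm_power)
  finally show False
    by simp
qed

lemma twisted_G5_zero_imp_R5:
  fixes \<sigma> :: real
  assumes u: "norm x = 1" "norm y = 1" "norm v = 1"
    and zero: "twisted_G5 x y v (of_real \<sigma>) = 0"
  shows "\<sigma> \<in> R5"
  unfolding R5_def closure_approachable
proof (intro allI impI)
  fix e :: real assume "e > 0"
  define S where "S = ball (complex_of_real \<sigma>) e"
  \<comment> \<open>The default branch covers the remaining prime 5.\<close>
  define w where "w p = (if p = 2 then x else if p = 3 then y else v)" for p :: nat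
  have "\<exists>t. \<forall>p\<in>{2,3,5}. dist (cis (t * ln (real p))) (w p) < inverse (real (Suc n))" for n
  proof -
    have "finite {2, 3, 5 :: nat}" "prime p" "norm (w p) = 1" if "p \<in> {2,3,5}" for p
      using that u by (auto simp: w_def)
    then show ?thesis
      using prime_powers_dense_torus[of "{2,3,5}" w "inverse (real (Suc n))"]
      by (metis inverse_positive_iff_positive of_nat_0_less_iff zero_less_Suc)
  qed
  then obtain T where T: "dist (cis (T n * ln (real p))) (w p) < inverse (real (Suc n))"
    if "p \<in> {2,3,5}" for n p
    by metis
  have lim: "(\<lambda>n. cis (T n * ln (real p))) \<longlonglongrightarrow> w p" if "p \<in> {2,3,5}" for p
    unfolding tendsto_dist_iff[of _ "w p"]
    by (rule tendsto_sandwich[OF _ _ tendsto_const LIMSEQ_inverse_real_of_nat])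
       (use T[OF that] in \<open>auto intro!: always_eventually less_imp_le simp del: of_nat_Suc\<close>)
  have lims: "(\<lambda>n. cis (T n * ln 2)) \<longlonglongrightarrow> x" "(\<lambda>n. cis (T n * ln 3)) \<longlonglongrightarrow> y"
    "(\<lambda>n. cis (T n * ln 5)) \<longlonglongrightarrow> v"
    using lim[of 2] lim[of 3] lim[of 5] by (simp_all add: w_def)
  have "\<exists>n. \<exists>z\<in>S. G5 (z + \<i> * of_real (T n)) = 0"
  proof (rule ccontr)
    assume nz: "\<nexists>n. \<exists>z\<in>S. G5 (z + \<i> * of_real (T n)) = 0"
    have "twisted_G5 x y v (of_real \<sigma>) \<noteq> 0"
    proof (rule Hurwitz_no_zeros[where S = S and
          \<F> = "\<lambda>n. twisted_G5 (cis (T n * ln 2)) (cis (T n * ln 3)) (cis (T n * ln 5))"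
          and g = "twisted_G5 x y v" and ?z0.0 = "of_real \<sigma>"])
      show "open S" "connected S" "of_real \<sigma> \<in> S"
        using \<open>e > 0\<close> by (auto simp: S_def)
      show "twisted_G5 (cis (T n * ln 2)) (cis (T n * ln 3)) (cis (T n * ln 5)) holomorphic_on S" for n
        by (rule holomorphic_twisted_G5)
      show "twisted_G5 x y v holomorphic_on S"
        by (rule holomorphic_twisted_G5)
      show "twisted_G5 (cis (T n * ln 2)) (cis (T n * ln 3)) (cis (T n * ln 5)) z \<noteq> 0" if "z \<in> S" for n z
        using nz that by (auto simp: G5_vertical_shift)
      \<comment> \<open>A constant value would be 0, the value at \<sigma>; the identity theorem
        would carry it from the ball to the point -3, where the function does not vanish.\<close>
      show "\<not> twisted_G5 x y v constant_on S"
      proof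
        assume "twisted_G5 x y v constant_on S"
        then have "twisted_G5 x y v z = 0" if "z \<in> S" for z
          using zero \<open>of_real \<sigma> \<in> S\<close> that by (metis constant_on_def)
        then have "twisted_G5 x y v (-3) = 0"
          using interior_limit_point[of "of_real \<sigma>" S] \<open>of_real \<sigma> \<in> S\<close> \<open>open S\<close>
            analytic_continuation[of "twisted_G5 x y v" UNIV S "of_real \<sigma>" "-3"]
          by (simp add: interior_open holomorphic_twisted_G5 connected_UNIV)
        then show False
          using twisted_G5_minus_3 u by blast
      qed
      \<comment> \<open>Only the coefficients depend on \<open>n\<close>, and each power function is
        bounded on the compact set \<open>K\<close>.\<close>
      show "uniform_limit K (\<lambda>n. twisted_G5 (cis (T n * ln 2)) (cis (T n * ln 3)) (cis (T n * ln 5)))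
              (twisted_G5 x y v) sequentially" if "compact K" for K
      proof -
        have const: "uniform_limit K (\<lambda>n z. a n) (\<lambda>z. l) sequentially"
          if "a \<longlonglongrightarrow> l" for a and l :: complex
          using that by (auto simp: uniform_limit_iff tendsto_iff elim: eventually_mono)
        have bdd: "bounded ((\<lambda>z. of_nat m powr z :: complex) ` K)" if "m > 0" for m
          using that \<open>compact K\<close>
          by (intro compact_imp_bounded compact_continuous_image continuous_intros) auto
        have powr_term: "uniform_limit K (\<lambda>n z. of_nat m powr z * a n) (\<lambda>z. of_nat m powr z * l) sequentially"
          if "a \<longlonglongrightarrow> l" "m > 0" for a m and l :: complex
          using that by (intro uniform_lim_mult[OF uniform_limit_const const bdd])
             (simp_all add: image_constant_conv)
        show ?thesis
          unfolding twisted_G5_def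
          using powr_term[OF lims(1), of 2] powr_term[OF lims(2), of 3] powr_term[OF tendsto_power[OF lims(1), of 2], of 4]
            powr_term[OF lims(3), of 5]
          by (intro uniform_limit_add uniform_limit_const) auto
      qed
    qed
    with zero show False
      by simp
  qed
  then obtain n z where z: "z \<in> S" "G5 (z + \<i> * of_real (T n)) = 0"
    by blast
  \<comment> \<open>The imaginary shift leaves the real part unchanged.\<close>
  have "dist (Re z) \<sigma> < e"
    using z(1) abs_Re_le_cmod[of "z - of_real \<sigma>"] by (auto simp: S_def dist_norm norm_minus_commute)
  then show "\<exists>y\<in>{Re s |s. G5 s = 0}. dist y \<sigma> < e"
    using z(2) by (intro bexI[of _ "Re z"]) (auto intro!: exI[of _ "z + \<i> * of_real (T n)"])
qed

section \<open>Real inequalities and the choice of twist\<close>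

text \<open>By monotonicity the endpoint suffices. There the two powers are at least 2/3 and 2/5,
  whose sum is 16/15; since -0.55 = -11/20, taking 20th powers makes these bounds rational.\<close>

lemma one_le_two_powr_plus_five_powr:
  fixes \<sigma> :: real
  assumes "\<sigma> \<ge> -0.55"
  shows "1 \<le> 2 powr \<sigma> + 5 powr \<sigma>"
proof -
  have bound: "a \<le> b powr -0.55" if "a > 0" "b > 0" "a ^ 20 * b ^ 11 \<le> 1" for a b :: real
  proof -
    have "(b powr -0.55) ^ 20 = b powr -11"
      using that by (simp add: powr_power)
    also have "\<dots> = inverse (b ^ 11)"
      using that by (simp add: powr_minus)
    also have "\<dots> \<ge> a ^ 20"
      using that by (simp add: field_simps)
    finally show ?thesis
      using that power_mono_iff[of a "b powr -0.55" 20] by simp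
  qed
  have "2 / 3 \<le> (2 :: real) powr -0.55" "2 / 5 \<le> (5 :: real) powr -0.55"
    by (rule bound; simp add: power_divide)+
  moreover have "(2 :: real) powr -0.55 \<le> 2 powr \<sigma>" "(5 :: real) powr -0.55 \<le> 5 powr \<sigma>"
    using assms by (auto intro!: powr_mono)
  ultimately show ?thesis
    by linarith
qed

text \<open>These compare \<open>5^\<sigma>\<close> with the modulus of the other four terms at
  angles 0 and \<open>pi\<close>, as the intermediate value theorem requires.\<close>

lemma powr_inequalities:
  fixes \<sigma> :: real
  assumes \<sigma>: "-0.55 \<le> \<sigma>" "\<sigma> \<le> 1"
  shows "5 powr \<sigma> \<le> 1 + 2 powr \<sigma> + 3 powr \<sigma> + 4 powr \<sigma>"
    and "\<bar>1 - 2 powr \<sigma> - 3 powr \<sigma> + 4 powr \<sigma>\<bar> \<le> 5 powr \<sigma>"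
proof -
  define r where "r = 2 powr \<sigma>"
  have r4: "4 powr \<sigma> = r\<^sup>2"
    using powr_mult[of 2 2 \<sigma>] by (simp add: r_def power2_eq_square)
  have r: "r > 0" "r \<le> 2"
    using powr_mono[OF \<sigma>(2), of 2] by (auto simp: r_def)
  \<comment> \<open>With \<open>three_le\<close> this yields
    \<open>5^\<sigma> - 3^\<sigma> \<le> 2/3 * 3^\<sigma> \<le> r\<close>, hence the first
    claim.\<close>
  have five_le: "5 powr \<sigma> \<le> 5 / 3 * 3 powr \<sigma>"
    using powr_mono[OF \<sigma>(2), of "5/3"] by (simp add: powr_divide field_simps)
  have three_le: "3 powr \<sigma> \<le> 3 / 2 * r"
    using powr_mono[OF \<sigma>(2), of "3/2"] by (simp add: powr_divide field_simps r_def)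
  show "5 powr \<sigma> \<le> 1 + 2 powr \<sigma> + 3 powr \<sigma> + 4 powr \<sigma>"
    using five_le three_le r4 r zero_le_power2[of r] unfolding r_def by linarith
  \<comment> \<open>For the lower side of the absolute value it now suffices that
    \<open>3^\<sigma>\<close> exceeds \<open>5^\<sigma>\<close> by at most 3/4.\<close>
  have quarter: "3 / 4 \<le> 1 - r + r\<^sup>2"
    using zero_le_square[of "r - 1/2"] by (simp add: algebra_simps power2_eq_square)
  have "3 powr \<sigma> \<le> 5 powr \<sigma> + 3 / 4"
  proof (cases "\<sigma> \<ge> 0")
    case True
    then show ?thesis
      using powr_mono2[of \<sigma> 3 5] by simp
  next
    case False
    have "3 powr \<sigma> \<le> (1 :: real)"
      using False powr_mono[of \<sigma> 0 3] by simp
    \<comment> \<open>As \<sigma> is at least -1, \<open>(5/3)^\<sigma>\<close> is at least 3/5; so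
      the excess is at most 2/5.\<close>
    moreover have "3 / 5 * 3 powr \<sigma> \<le> 5 powr \<sigma>"
      using powr_mono[of "-1" \<sigma> "5/3"] \<sigma> by (simp add: powr_divide powr_minus field_simps)
    ultimately show ?thesis
      by linarith
  qed
  \<comment> \<open>The upper side of the absolute value; for negative \<sigma> it reduces to the
    numerical bound coming from -0.55.\<close>
  moreover have "1 + 4 powr \<sigma> \<le> 2 powr \<sigma> + 3 powr \<sigma> + 5 powr \<sigma>"
  proof (cases "\<sigma> \<ge> 0")
    case True
    have "4 powr \<sigma> \<le> 5 powr \<sigma>" "1 \<le> 2 powr \<sigma>" "3 powr \<sigma> \<ge> 0"
      using True by (auto intro: powr_mono2 ge_one_powr_ge_zero)
    then show ?thesis
      by linarith
  next
    case False
    have "4 powr \<sigma> \<le> 3 powr \<sigma>"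
      using False by (intro powr_mono2') auto
    then show ?thesis
      using one_le_two_powr_plus_five_powr[OF \<sigma>(1)] by linarith
  qed
  ultimately show "\<bar>1 - 2 powr \<sigma> - 3 powr \<sigma> + 4 powr \<sigma>\<bar> \<le> 5 powr \<sigma>"
    using quarter r4 by (simp add: r_def abs_le_iff)
qed

lemma ex_twisted_G5_zero:
  fixes \<sigma> :: real
  assumes \<sigma>: "-0.55 \<le> \<sigma>" "\<sigma> \<le> 1"
  obtains x v where "norm x = 1" "norm v = 1" "twisted_G5 x x v (of_real \<sigma>) = 0"
proof -
  define f where
    "f \<theta> = 1 + of_real (2 powr \<sigma>) * cis \<theta> + of_real (3 powr \<sigma>) * cis \<theta> + of_real (4 powr \<sigma>) * (cis \<theta>)\<^sup>2"
    for \<theta>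
  have f0: "f 0 = of_real (1 + 2 powr \<sigma> + 3 powr \<sigma> + 4 powr \<sigma>)"
    and fpi: "f pi = of_real (1 - 2 powr \<sigma> - 3 powr \<sigma> + 4 powr \<sigma>)"
    by (simp_all add: f_def)
  have "norm (f pi) \<le> 5 powr \<sigma>" "5 powr \<sigma> \<le> norm (f 0)"
    using powr_inequalities[OF \<sigma>] by (auto simp: f0 fpi simp del: of_real_add of_real_diff of_real_1)
  moreover have "continuous_on {0..pi} (\<lambda>\<theta>. norm (f \<theta>))"
    unfolding f_def by (intro continuous_intros)
  ultimately obtain \<theta> where \<theta>: "norm (f \<theta>) = 5 powr \<sigma>"
    using IVT2'[of "\<lambda>\<theta>. norm (f \<theta>)" pi "5 powr \<sigma>" 0] by auto
  \<comment> \<open>Solves for the coefficient of \<open>5^\<sigma>\<close> that cancels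
    \<open>f \<theta>\<close>; the choice of \<theta> makes it unimodular.\<close>
  define v where "v = - f \<theta> / of_real (5 powr \<sigma>)"
  have "norm v = 1"
    using \<theta> by (simp add: v_def norm_divide)
  have powr_real: "of_nat m powr of_real \<sigma> = (of_real (real m powr \<sigma>) :: complex)" for m
    using powr_of_real[of "real m" \<sigma>] by simp
  have "twisted_G5 (cis \<theta>) (cis \<theta>) v (of_real \<sigma>) = f \<theta> + of_real (5 powr \<sigma>) * v"
    using powr_real[of 2] powr_real[of 3] powr_real[of 4] powr_real[of 5]
    by (simp add: twisted_G5_def f_def)
  then have "twisted_G5 (cis \<theta>) (cis \<theta>) v (of_real \<sigma>) = 0"
    by (simp add: v_def)
  then show thesis
    using that[of "cis \<theta>" v] \<open>norm v = 1\<close> by simp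
qed

theorem corollary6:
  shows "{-0.55..1} \<subseteq> R5"
proof
  fix \<sigma> :: real assume "\<sigma> \<in> {-0.55..1}"
  then have "-0.55 \<le> \<sigma>" "\<sigma> \<le> 1"
    by auto
  then obtain x v where "norm x = 1" "norm v = 1" "twisted_G5 x x v (of_real \<sigma>) = 0"
    by (rule ex_twisted_G5_zero)
  then show "\<sigma> \<in> R5"
    by (intro twisted_G5_zero_imp_R5)
qed

end
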